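(* Let $0<\alpha<1$ and let $A$ be a selfadjoint operator in a separable Hilbert space $H$. Let $F\in L^\infty((0,\infty);H)$ and $x\in H$. For $\varepsilon>0$ let $u_\varepsilon$ be the mild solution on $[0,\infty)$ of $$iD_t^\alpha u_\varepsilon(t)+\varepsilon Au_\varepsilon(t)+F(t)=0,\qquad u_\varepsilon(0)=x.$$ Then $$\lim_{\varepsilon\to0}u_\varepsilon(t)=x+iI_t^\alpha F(t)$$ in $H$, pointwise for $t\in[0,\infty)$.
   Context: $D_t^\alpha$ is the Caputo derivative, and $I_t^\alpha F(t)=\frac1{\Gamma(\alpha)}\int_0^t(t-\tau)^{\alpha-1}F(\tau)\,d\tau$ is the Riemann--Liouville fractional integral. $E_{\alpha,\beta}(z)=\sum_{k\ge0}z^k/\Gamma(\alpha k+\beta)$. By the spectral theorem fix a finite measure space $(\Omega,\mu)$, a unitary $U:L^2(\Omega)\to H$ and a real-valued function $a(\xi)$ on $\Omega$, finite a.e., such that $A$ is unitarily equivalent via $U$ to multiplication by $a$: $\psi\in D(A)$ iff $aU^{-1}\psi\in L^2(\Omega)$, and $A\psi=U(a(\xi)U^{-1}\psi)$. Define for $t\ge0$ (resp. $t>0$) $$S_t\phi=U\big(E_{\alpha,1}(ia(\xi)t^\alpha)U^{-1}\phi\big),\qquad P_t\phi=U\big(t^{\alpha-1}E_{\alpha,\alpha}(ia(\xi)t^\alpha)U^{-1}\phi\big).$$ The mild solution of $iD_t^\alpha u+Au+F(t)=0$, $u(0)=x$, is $u(t)=S_tx+i\int_0^tP_{t-\tau}F(\tau)\,d\tau$.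 Applied with $\varepsilon A$ in place of $A$ this gives the mild solution $$u_\varepsilon(t)=S_{\varepsilon^{1/\alpha}t}x+i\varepsilon^{\frac1\alpha-1}\int_0^tP_{\varepsilon^{1/\alpha}(t-\tau)}F(\tau)\,d\tau .$$ *)

theory Defs
  imports "HOL-Analysis.Analysis"
begin

(* The inner product is conjugate-linear in the first argument and linear in the second; the norm
   and the topology are those of the underlying real inner product space.  Definiteness and
   scaleC 1 x = x are inherited through inner_eq_Re_cinner and scaleR_eq_scaleC. *)
class complex_inner = real_inner +
  fixes scaleC :: "complex \<Rightarrow> 'a \<Rightarrow> 'a"  (infixr "*\<^sub>C" 75)
    and cinner :: "'a \<Rightarrow> 'a \<Rightarrow> complex"
  assumes scaleC_add_right: "c *\<^sub>C (x + y) = c *\<^sub>C x + c *\<^sub>C y"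
    and scaleC_add_left: "(b + c) *\<^sub>C x = b *\<^sub>C x + c *\<^sub>C x"
    and scaleC_scaleC: "b *\<^sub>C c *\<^sub>C x = (b * c) *\<^sub>C x"
    and scaleR_eq_scaleC: "scaleR r x = complex_of_real r *\<^sub>C x"
    and cinner_commute: "cinner x y = cnj (cinner y x)"
    and cinner_add_right: "cinner x (y + z) = cinner x y + cinner x z"
    and cinner_scaleC_right: "cinner x (c *\<^sub>C y) = c * cinner x y"
    and inner_eq_Re_cinner: "inner x y = Re (cinner x y)"

class complex_hilbert_space = complex_inner + banach

(* An unbounded operator is a domain D together with a function A that is only meaningful on D.
   The last conjunct says that the graph of the adjoint of A is the graph of A. *)
definition selfadjoint_operator :: "'h::complex_hilbert_space set \<Rightarrow> ('h \<Rightarrow> 'h) \<Rightarrow> bool" where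
  "selfadjoint_operator D A \<longleftrightarrow>
     0 \<in> D \<and>
     (\<forall>\<phi>\<in>D. \<forall>\<psi>\<in>D. \<phi> + \<psi> \<in> D \<and> A (\<phi> + \<psi>) = A \<phi> + A \<psi>) \<and>
     (\<forall>c. \<forall>\<phi>\<in>D. c *\<^sub>C \<phi> \<in> D \<and> A (c *\<^sub>C \<phi>) = c *\<^sub>C A \<phi>) \<and>
     closure D = UNIV \<and>
     (\<forall>\<psi> \<eta>. (\<forall>\<phi>\<in>D. cinner \<psi> (A \<phi>) = cinner \<eta> \<phi>) \<longleftrightarrow> \<psi> \<in> D \<and> \<eta> = A \<psi>)"

(* Elements of L^2 are represented by functions, not by classes modulo null sets. *)
definition L2 :: "'w measure \<Rightarrow> ('w \<Rightarrow> complex) set" where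
  "L2 M = {f \<in> borel_measurable M. integrable M (\<lambda>\<xi>. (cmod (f \<xi>))\<^sup>2)}"

(* Preservation of the inner product makes U constant on classes modulo null sets and injective
   on the set of these classes. *)
definition unitary_L2 :: "'w measure \<Rightarrow> (('w \<Rightarrow> complex) \<Rightarrow> 'h::complex_hilbert_space) \<Rightarrow> bool" where
  "unitary_L2 M U \<longleftrightarrow>
     (\<forall>f\<in>L2 M. \<forall>g\<in>L2 M. U (\<lambda>\<xi>. f \<xi> + g \<xi>) = U f + U g) \<and>
     (\<forall>c. \<forall>f\<in>L2 M. U (\<lambda>\<xi>. c * f \<xi>) = c *\<^sub>C U f) \<and>
     (\<forall>f\<in>L2 M. \<forall>g\<in>L2 M. cinner (U f) (U g) = (LINT \<xi>|M. cnj (f \<xi>) * g \<xi>)) \<and>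
     U ` L2 M = UNIV"

(* A representative of the inverse image under U, determined up to a null set. *)
definition U_inv :: "'w measure \<Rightarrow> (('w \<Rightarrow> complex) \<Rightarrow> 'h) \<Rightarrow> 'h \<Rightarrow> 'w \<Rightarrow> complex" where
  "U_inv M U = inv_into (L2 M) U"

definition multiplier ::
  "'w measure \<Rightarrow> (('w \<Rightarrow> complex) \<Rightarrow> 'h) \<Rightarrow> ('w \<Rightarrow> complex) \<Rightarrow> 'h \<Rightarrow> 'h" where
  "multiplier M U m \<phi> = U (\<lambda>\<xi>. m \<xi> * U_inv M U \<phi> \<xi>)"

definition spectral_representation ::
  "'w measure \<Rightarrow> (('w \<Rightarrow> complex) \<Rightarrow> 'h::complex_hilbert_space) \<Rightarrow> ('w \<Rightarrow> real) \<Rightarrow>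
   'h set \<Rightarrow> ('h \<Rightarrow> 'h) \<Rightarrow> bool" where
  "spectral_representation M U a D A \<longleftrightarrow>
     finite_measure M \<and> unitary_L2 M U \<and> a \<in> borel_measurable M \<and>
     (\<forall>\<psi>. \<psi> \<in> D \<longleftrightarrow> (\<lambda>\<xi>. complex_of_real (a \<xi>) * U_inv M U \<psi> \<xi>) \<in> L2 M) \<and>
     (\<forall>\<psi>\<in>D. A \<psi> = multiplier M U (\<lambda>\<xi>. complex_of_real (a \<xi>)) \<psi>)"

definition mittag_leffler :: "real \<Rightarrow> real \<Rightarrow> complex \<Rightarrow> complex" where
  "mittag_leffler \<alpha> \<beta> z = (\<Sum>k. z ^ k / complex_of_real (Gamma (\<alpha> * real k + \<beta>)))"

definition S_op ::
  "real \<Rightarrow> 'w measure \<Rightarrow> (('w \<Rightarrow> complex) \<Rightarrow> 'h) \<Rightarrow> ('w \<Rightarrow> real) \<Rightarrow> real \<Rightarrow> 'h \<Rightarrow> 'h" where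
  "S_op \<alpha> M U a t = multiplier M U
     (\<lambda>\<xi>. mittag_leffler \<alpha> 1 (\<i> * complex_of_real (a \<xi> * t powr \<alpha>)))"

definition P_op ::
  "real \<Rightarrow> 'w measure \<Rightarrow> (('w \<Rightarrow> complex) \<Rightarrow> 'h) \<Rightarrow> ('w \<Rightarrow> real) \<Rightarrow> real \<Rightarrow> 'h \<Rightarrow> 'h" where
  "P_op \<alpha> M U a t = multiplier M U
     (\<lambda>\<xi>. complex_of_real (t powr (\<alpha> - 1)) *
           mittag_leffler \<alpha> \<alpha> (\<i> * complex_of_real (a \<xi> * t powr \<alpha>)))"

(* The mild solution of i D_t^alpha u + A u + F = 0, u(0) = x (Caputo derivative), where A is the
   operator that U conjugates to multiplication by a. *)
definition mild_solution ::
  "real \<Rightarrow> 'w measure \<Rightarrow> (('w \<Rightarrow> complex) \<Rightarrow> 'h) \<Rightarrow> ('w \<Rightarrow> real) \<Rightarrow>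
   (real \<Rightarrow> 'h) \<Rightarrow> 'h \<Rightarrow> real \<Rightarrow> 'h::{complex_hilbert_space, second_countable_topology}" where
  "mild_solution \<alpha> M U a F x t =
     S_op \<alpha> M U a t x + \<i> *\<^sub>C (LINT \<tau>:{0<..<t}|lebesgue. P_op \<alpha> M U a (t - \<tau>) (F \<tau>))"

definition riemann_liouville_integral ::
  "real \<Rightarrow> (real \<Rightarrow> 'h) \<Rightarrow> real \<Rightarrow> 'h::{banach, second_countable_topology}" where
  "riemann_liouville_integral \<alpha> F t =
     (1 / Gamma \<alpha>) *\<^sub>R (LINT \<tau>:{0<..<t}|lebesgue. (t - \<tau>) powr (\<alpha> - 1) *\<^sub>R F \<tau>)"

(* In a separable Banach space, Borel measurability is strong measurability.  Values of F outside
   the open half-line are irrelevant. *)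
definition L_infinity_half_line ::
  "(real \<Rightarrow> 'h::{banach, second_countable_topology}) \<Rightarrow> bool" where
  "L_infinity_half_line F \<longleftrightarrow>
     F \<in> borel_measurable (lebesgue_on {0<..}) \<and>
     (\<exists>C. AE \<tau> in lebesgue_on {0<..}. norm (F \<tau>) \<le> C)"

(* Multiplication by eps * a, with the same U, represents eps * A. *)
lemma spectral_representation_scale:
  assumes "spectral_representation M U a D A" and "\<epsilon> > (0::real)"
  shows "spectral_representation M U (\<lambda>\<xi>. \<epsilon> * a \<xi>) D (\<lambda>\<psi>. \<epsilon> *\<^sub>R A \<psi>)"
proof -
  have eq: "(\<lambda>\<xi>. complex_of_real (\<epsilon> * a \<xi>) * f \<xi>) =
            (\<lambda>\<xi>. complex_of_real \<epsilon> * (complex_of_real (a \<xi>) * f \<xi>))" for f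
    by (simp add: mult.assoc)
  have L2: "(\<lambda>\<xi>. complex_of_real c * f \<xi>) \<in> L2 M" if "f \<in> L2 M" for c f
    using that unfolding L2_def
    by (auto simp: norm_mult power_mult_distrib intro!: borel_measurable_times)
  have iff: "(\<lambda>\<xi>. complex_of_real \<epsilon> * f \<xi>) \<in> L2 M \<longleftrightarrow> f \<in> L2 M" for f
    using L2[of f \<epsilon>] L2[of "\<lambda>\<xi>. complex_of_real \<epsilon> * f \<xi>" "1 / \<epsilon>"] assms(2) by auto
  show ?thesis
    using assms(1) unfolding spectral_representation_def multiplier_def eq iff
    by (auto simp: unitary_L2_def scaleR_eq_scaleC)
qed

end

theory Submission
  imports Defs "HOL-Real_Asymp.Real_Asymp"
begin

text \<open>
  Everything rests on the bound |E(z)| \<le> 1 / Gamma(\<beta>) for the Mittag-Leffler function with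
  parameters 0 < \<alpha> \<le> 1 and \<beta> \<ge> \<alpha> on the half-plane Re z \<le> 0, which contains the imaginary axis.
  It is inherited from the Gruenwald-Letnikov discretization of the fractional equation, whose
  solution operator is the coefficient sequence of 1 / ((1 - w)^\<alpha> - \<mu>).  As the coefficients of
  1 - (1 - w)^\<alpha> are nonnegative and |1 - \<mu>| \<ge> 1, these coefficients are dominated by their values
  at \<mu> = 0; with \<mu> = z / n^\<alpha>, the n-th one, rescaled, converges to the Mittag-Leffler function.
  The multipliers in the mild solution are therefore bounded uniformly in \<epsilon> and converge pointwise,
  so that dominated convergence applies twice: in the spectral variable and in time.
\<close>

section \<open>The Mittag-Leffler function on the left half-plane\<close>

text \<open>The coefficient of w^n in (1 - w)^(- a).\<close>
definition multichoose :: "real \<Rightarrow> nat \<Rightarrow> real" where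
  "multichoose a n = pochhammer a n / fact n"

lemma multichoose_0 [simp]: "multichoose a 0 = 1"
  by (simp add: multichoose_def)

lemma multichoose_Suc: "multichoose a (Suc n) = multichoose a n * (a + n) / Suc n"
  by (simp add: multichoose_def pochhammer_Suc field_simps)

lemma multichoose_zero_left: "multichoose 0 n = (if n = 0 then 1 else 0)"
  by (cases n) (simp_all add: multichoose_def pochhammer_rec)

lemma multichoose_nonneg: "0 \<le> a \<Longrightarrow> 0 \<le> multichoose a n"
  by (induction n) (simp_all add: multichoose_Suc)

text \<open>In the product for \<open>pochhammer (- a) n\<close> the first factor - a is nonpositive
  and, since a \<le> 1, all later ones are nonnegative. Hence 1 - (1 - w)^a has nonnegative
  coefficients.\<close>

lemma multichoose_nonpos:
  assumes "0 \<le> a" "a \<le> 1" "n > 0"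
  shows "multichoose (- a) n \<le> 0"
proof -
  have "multichoose (- a) (Suc m) \<le> 0" for m
  proof (induction m)
    case 0
    then show ?case using assms by (simp add: multichoose_Suc)
  next
    case (Suc m)
    then show ?case using assms multichoose_Suc[of "- a" "Suc m"]
      by (simp add: divide_nonpos_pos mult_nonpos_nonneg)
  qed
  then show ?thesis using assms(3) by (cases n) auto
qed

text \<open>Coefficient form of (1 - w)^(- a) (1 - w)^(- b) = (1 - w)^(- a - b). The sign (- 1)^n
  turns it into Vandermonde's identity for generalized binomial coefficients.\<close>

lemma multichoose_Vandermonde:
  "(\<Sum>j\<le>n. multichoose a j * multichoose b (n - j)) = multichoose (a + b) n"
proof -
  have g: "multichoose c k = (- 1) ^ k * (- c gchoose k)" for c k
    by (simp add: multichoose_def gbinomial_pochhammer)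
  have "(\<Sum>j\<le>n. multichoose a j * multichoose b (n - j)) =
      (\<Sum>j\<le>n. (- 1) ^ n * ((- a gchoose j) * (- b gchoose (n - j))))"
  proof (rule sum.cong)
    fix j assume "j \<in> {..n}"
    then have "(- 1 :: real) ^ n = (- 1) ^ j * (- 1) ^ (n - j)"
      by (simp flip: power_add)
    then show "multichoose a j * multichoose b (n - j) =
        (- 1) ^ n * ((- a gchoose j) * (- b gchoose (n - j)))"
      by (simp add: g)
  qed simp
  also have "\<dots> = multichoose (a + b) n"
    using gbinomial_Vandermonde[of "- a" "- b" n]
    by (simp add: g atLeast0AtMost flip: sum_distrib_left)
  finally show ?thesis .
qed

text \<open>For fixed n the coefficient is a polynomial in k of degree n, which a geometric factor
  beats. The induction on n removes one linear factor at a time, at the price of a larger radius;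
  therefore r is arbitrary.\<close>

lemma summable_multichoose_powser:
  fixes r :: real
  assumes "0 \<le> r" "r < 1" "0 < \<alpha>" "0 < \<beta>"
  shows "summable (\<lambda>k. r ^ k * multichoose (\<alpha> * real k + \<beta>) n)"
  using assms
proof (induction n arbitrary: r)
  case 0
  then show ?case by (simp add: summable_geometric)
next
  case (Suc n)
  \<comment> \<open>The ratio (r / s)^k absorbs the new linear factor in k, and the induction
    hypothesis is applied at radius s.\<close>
  obtain s where s: "r < s" "s < 1" using Suc.prems(2) dense by blast
  have q: "0 \<le> r / s" "r / s < 1" using s Suc.prems by (auto simp: field_simps)
  have "norm (r / s) < 1" using q by (simp only: real_norm_def abs_of_nonneg)
  then have "(\<lambda>k. real k * (r / s) ^ k) \<longlonglongrightarrow> 0"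
    by (rule powser_times_n_limit_0)
  moreover have "(\<lambda>k. (r / s) ^ k) \<longlonglongrightarrow> 0"
    using q by (rule LIMSEQ_realpow_zero)
  ultimately have "(\<lambda>k. \<alpha> * (real k * (r / s) ^ k) + (\<beta> + n) * (r / s) ^ k) \<longlonglongrightarrow> \<alpha> * 0 + (\<beta> + n) * 0"
    by (intro tendsto_add tendsto_mult_left)
  then have "\<forall>\<^sub>F k in sequentially. \<alpha> * (real k * (r / s) ^ k) + (\<beta> + n) * (r / s) ^ k < 1"
    by (intro order_tendstoD) auto
  then have ev: "\<forall>\<^sub>F k in sequentially.
      norm (r ^ k * multichoose (\<alpha> * real k + \<beta>) (Suc n))
        \<le> s ^ k * multichoose (\<alpha> * real k + \<beta>) n"
  proof eventually_elim
    case (elim k)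
    let ?g = "multichoose (\<alpha> * real k + \<beta>) n"
    have g: "0 \<le> ?g" using Suc.prems by (simp add: multichoose_nonneg)
    have "r ^ k * (\<alpha> * real k + \<beta> + n) = s ^ k * (\<alpha> * (real k * (r / s) ^ k) + (\<beta> + n) * (r / s) ^ k)"
      using s Suc.prems by (simp add: power_divide field_simps)
    also have "\<dots> \<le> s ^ k"
      using elim s Suc.prems by (intro mult_left_le) auto
    finally have le: "r ^ k * (\<alpha> * real k + \<beta> + n) \<le> s ^ k" .
    have "norm (r ^ k * multichoose (\<alpha> * real k + \<beta>) (Suc n)) =
        (r ^ k * (\<alpha> * real k + \<beta> + n)) * ?g / Suc n"
      using g Suc.prems by (simp add: multichoose_Suc abs_mult)
    also have "\<dots> \<le> (r ^ k * (\<alpha> * real k + \<beta> + n)) * ?g"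
    proof -
      have "0 \<le> (r ^ k * (\<alpha> * real k + \<beta> + n)) * ?g" using g Suc.prems by simp
      then show ?thesis
        using divide_left_mono[of 1 "real (Suc n)" "(r ^ k * (\<alpha> * real k + \<beta> + n)) * ?g"] by simp
    qed
    also have "\<dots> \<le> s ^ k * ?g"
      using le g by (rule mult_right_mono)
    finally show ?case .
  qed
  have "summable (\<lambda>k. s ^ k * multichoose (\<alpha> * real k + \<beta>) n)"
    using Suc s by auto
  then show ?case
    using summable_comparison_test_ev[OF ev] by blast
qed

section \<open>Discrete resolvent coefficients and their domination by the case \<mu> = 0\<close>

text \<open>The coefficient of w^n in (1 - w)^(\<alpha> - \<beta>) / ((1 - w)^\<alpha> - \<mu>), expanded in powers of \<mu>.\<close>
definition ml_discrete :: "real \<Rightarrow> real \<Rightarrow> complex \<Rightarrow> nat \<Rightarrow> complex" where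
  "ml_discrete \<alpha> \<beta> \<mu> n = (\<Sum>k. \<mu> ^ k * complex_of_real (multichoose (\<alpha> * real k + \<beta>) n))"

lemma summable_ml_discrete:
  assumes "cmod \<mu> < 1" "0 < \<alpha>" "0 < \<beta>"
  shows "summable (\<lambda>k. \<mu> ^ k * complex_of_real (multichoose (\<alpha> * real k + \<beta>) n))"
proof (rule summable_norm_cancel)
  show "summable (\<lambda>k. norm (\<mu> ^ k * complex_of_real (multichoose (\<alpha> * real k + \<beta>) n)))"
    using summable_multichoose_powser[of "cmod \<mu>" \<alpha> \<beta> n] assms
    by (simp add: norm_mult norm_power multichoose_nonneg)
qed

text \<open>Multiplying the generating function by (1 - w)^(- \<gamma>) shifts \<beta> to \<beta> +
  \<gamma>. The form with \<open>sums\<close> also covers \<beta> + \<gamma> \<le> 0, where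
  \<open>summable_ml_discrete\<close> does not apply.\<close>

lemma ml_discrete_convolution:
  assumes "cmod \<mu> < 1" "0 < \<alpha>" "0 < \<beta>"
  shows "(\<lambda>k. \<mu> ^ k * complex_of_real (multichoose (\<alpha> * real k + \<beta> + \<gamma>) n)) sums
     (\<Sum>j\<le>n. complex_of_real (multichoose \<gamma> j) * ml_discrete \<alpha> \<beta> \<mu> (n - j))"
proof -
  have "(\<lambda>k. \<Sum>j\<le>n. complex_of_real (multichoose \<gamma> j) *
          (\<mu> ^ k * complex_of_real (multichoose (\<alpha> * real k + \<beta>) (n - j)))) sums
     (\<Sum>j\<le>n. complex_of_real (multichoose \<gamma> j) * ml_discrete \<alpha> \<beta> \<mu> (n - j))"
    unfolding ml_discrete_def
    by (intro sums_sum sums_mult summable_sums summable_ml_discrete assms)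
  moreover have "(\<Sum>j\<le>n. complex_of_real (multichoose \<gamma> j) *
          (\<mu> ^ k * complex_of_real (multichoose (\<alpha> * real k + \<beta>) (n - j)))) =
      \<mu> ^ k * complex_of_real (multichoose (\<alpha> * real k + \<beta> + \<gamma>) n)" for k
    using multichoose_Vandermonde[of \<gamma> "\<alpha> * real k + \<beta>" n, symmetric]
    by (simp add: sum_distrib_left mult_ac add_ac)
  ultimately show ?thesis by simp
qed

text \<open>Comparison of coefficients in ((1 - w)^\<alpha> - \<mu>) G(w) = 1, where G is the
  generating function for \<beta> = \<alpha>. The term j = 0 of (1 - w)^\<alpha> has been moved to
  the left and joins \<mu> there.\<close>

lemma ml_discrete_recurrence:
  assumes "cmod \<mu> < 1" "0 < \<alpha>"
  shows "(1 - \<mu>) * ml_discrete \<alpha> \<alpha> \<mu> n = (if n = 0 then 1 else 0) +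
     (\<Sum>j\<in>{1..n}. complex_of_real (- multichoose (- \<alpha>) j) * ml_discrete \<alpha> \<alpha> \<mu> (n - j))"
proof -
  have "(\<lambda>k. \<mu> ^ k * complex_of_real (multichoose (\<alpha> * real k) n)) sums
     (\<Sum>j\<le>n. complex_of_real (multichoose (- \<alpha>) j) * ml_discrete \<alpha> \<alpha> \<mu> (n - j))"
    using ml_discrete_convolution[of \<mu> \<alpha> \<alpha> "- \<alpha>" n] assms by simp
  \<comment> \<open>Since \<alpha> k + \<alpha> = \<alpha> (k + 1), \<mu> times the series is the
    preceding series without its term k = 0. That term is \<open>multichoose 0 n\<close>, the
    indicator of n = 0.\<close>
  moreover have "(\<lambda>k. \<mu> ^ Suc k * complex_of_real (multichoose (\<alpha> * real (Suc k)) n)) sums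
     (\<mu> * ml_discrete \<alpha> \<alpha> \<mu> n)"
    using sums_mult[OF summable_sums[OF summable_ml_discrete[OF assms(1,2,2), of n]], of \<mu>]
    by (simp add: ml_discrete_def algebra_simps)
  then have "(\<lambda>k. \<mu> ^ k * complex_of_real (multichoose (\<alpha> * real k) n)) sums
     (\<mu> * ml_discrete \<alpha> \<alpha> \<mu> n + (if n = 0 then 1 else 0))"
    by (subst (asm) sums_Suc_iff) (cases "n = 0"; simp add: multichoose_zero_left)
  ultimately have "(\<Sum>j\<le>n. complex_of_real (multichoose (- \<alpha>) j) * ml_discrete \<alpha> \<alpha> \<mu> (n - j)) =
     \<mu> * ml_discrete \<alpha> \<alpha> \<mu> n + (if n = 0 then 1 else 0)"
    by (rule sums_unique2)
  moreover have "{..n} = insert 0 {1..n}" by auto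
  ultimately show ?thesis
    by (simp add: sum_negf algebra_simps)
qed

text \<open>The same recurrence at \<mu> = 0; it is satisfied by the majorant.\<close>

lemma multichoose_recurrence:
  "multichoose \<alpha> n = (if n = 0 then 1 else 0) +
     (\<Sum>j\<in>{1..n}. - multichoose (- \<alpha>) j * multichoose \<alpha> (n - j))"
proof -
  have "{..n} = insert 0 {1..n}" by auto
  then show ?thesis
    using multichoose_Vandermonde[of "- \<alpha>" \<alpha> n]
    by (simp add: multichoose_zero_left sum_negf)
qed

text \<open>Both recurrences have the same nonnegative weights, and the factor 1 - \<mu> on the left
  has modulus at least 1 because Re \<mu> \<le> 0. Strong induction then compares them term by
  term.\<close>

lemma norm_ml_discrete_diagonal_le:
  assumes "cmod \<mu> < 1" "Re \<mu> \<le> 0" "0 < \<alpha>" "\<alpha> \<le> 1"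
  shows "cmod (ml_discrete \<alpha> \<alpha> \<mu> n) \<le> multichoose \<alpha> n"
proof (induction n rule: less_induct)
  case (less n)
  have "1 \<le> Re (1 - \<mu>)" using assms by simp
  then have "1 \<le> cmod (1 - \<mu>)" using complex_Re_le_cmod order_trans by blast
  then have "cmod (ml_discrete \<alpha> \<alpha> \<mu> n) \<le> cmod (1 - \<mu>) * cmod (ml_discrete \<alpha> \<alpha> \<mu> n)"
    by (simp add: mult_le_cancel_right1)
  also have "\<dots> = cmod ((1 - \<mu>) * ml_discrete \<alpha> \<alpha> \<mu> n)"
    by (simp add: norm_mult)
  also have "\<dots> \<le> (if n = 0 then 1 else 0) +
     (\<Sum>j\<in>{1..n}. - multichoose (- \<alpha>) j * multichoose \<alpha> (n - j))"
    unfolding ml_discrete_recurrence[OF assms(1,3)]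
  proof (intro norm_triangle_mono sum_norm_le)
    fix j assume j: "j \<in> {1..n}"
    have w: "multichoose (- \<alpha>) j \<le> 0" using assms j by (intro multichoose_nonpos) auto
    have "cmod (ml_discrete \<alpha> \<alpha> \<mu> (n - j)) \<le> multichoose \<alpha> (n - j)"
      using j by (intro less) auto
    then show "cmod (complex_of_real (- multichoose (- \<alpha>) j) * ml_discrete \<alpha> \<alpha> \<mu> (n - j))
        \<le> - multichoose (- \<alpha>) j * multichoose \<alpha> (n - j)"
      using w by (simp add: norm_mult mult_left_mono_neg)
  qed simp
  also have "\<dots> = multichoose \<alpha> n" by (rule multichoose_recurrence[symmetric])
  finally show ?case .
qed

text \<open>The additional factor (1 - w)^(\<alpha> - \<beta>) has nonnegative coefficients as
  \<beta> \<ge> \<alpha>, so convolution with them preserves the diagonal bound.\<close>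

lemma norm_ml_discrete_le:
  assumes "cmod \<mu> < 1" "Re \<mu> \<le> 0" "0 < \<alpha>" "\<alpha> \<le> 1" "\<alpha> \<le> \<beta>"
  shows "cmod (ml_discrete \<alpha> \<beta> \<mu> n) \<le> multichoose \<beta> n"
proof -
  have "ml_discrete \<alpha> \<beta> \<mu> n =
      (\<Sum>j\<le>n. complex_of_real (multichoose (\<beta> - \<alpha>) j) * ml_discrete \<alpha> \<alpha> \<mu> (n - j))"
    using sums_unique[OF ml_discrete_convolution[of \<mu> \<alpha> \<alpha> "\<beta> - \<alpha>" n]] assms
    by (simp add: ml_discrete_def)
  also have "cmod \<dots> \<le> (\<Sum>j\<le>n. multichoose (\<beta> - \<alpha>) j * multichoose \<alpha> (n - j))"
    using assms
    by (intro sum_norm_le)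
       (simp add: norm_mult multichoose_nonneg mult_left_mono norm_ml_discrete_diagonal_le)
  also have "\<dots> = multichoose \<beta> n" by (simp add: multichoose_Vandermonde)
  finally show ?thesis .
qed

section \<open>Asymptotics of the coefficients, and bounds by the reciprocal Gamma function\<close>

text \<open>This is the Euler product limit for 1 / Gamma up to the factor n / (a + n), which tends
  to 1. At the poles both sides are 0, by the conventions for \<open>Gamma\<close> and for division
  by zero.\<close>

lemma multichoose_asymptotics:
  "(\<lambda>n. multichoose a n * real n powr (1 - a)) \<longlonglongrightarrow> 1 / Gamma a"
proof -
  have "(\<lambda>n. rGamma_series a n * (real n / (a + real n))) \<longlonglongrightarrow> rGamma a * 1"
    by (intro tendsto_mult rGamma_series_LIMSEQ) real_asymp
  moreover have "\<forall>\<^sub>F n in sequentially. rGamma_series a n * (real n / (a + real n)) =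
      multichoose a n * real n powr (1 - a)"
    using eventually_gt_at_top[of "nat \<lceil>\<bar>a\<bar>\<rceil>"]
  proof eventually_elim
    case (elim n)
    then have n: "a + real n > 0" "real n > 0" by linarith+
    have p: "real n powr (1 - a) = real n / exp (a * ln (real n))"
      using n by (simp add: powr_diff) (simp add: powr_def)
    show ?case
      unfolding p using n
      by (simp add: rGamma_series_def multichoose_def pochhammer_Suc)
  qed
  ultimately show ?thesis
    by (simp add: tendsto_cong rGamma_inverse_Gamma inverse_eq_divide)
qed

text \<open>Bernoulli's inequality from concavity of ln: 1 + y is the mean of 1 and 1 + a y with
  weights 1 - 1 / a and 1 / a.\<close>

lemma powr_one_plus_ge:
  assumes "1 \<le> a" "0 \<le> (y::real)"
  shows "1 + a * y \<le> (1 + y) powr a"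
proof -
  have "(1 - 1 / a) * ln 1 + 1 / a * ln (1 + a * y) \<le> ln ((1 - 1 / a) *\<^sub>R 1 + (1 / a) *\<^sub>R (1 + a * y))"
    using assms by (intro concave_onD[OF ln_concave]) (auto intro: add_pos_nonneg)
  also have "(1 - 1 / a) *\<^sub>R 1 + (1 / a) *\<^sub>R (1 + a * y) = 1 + y"
    using assms by (simp add: field_simps)
  finally have "ln (1 + a * y) \<le> a * ln (1 + y)"
    using assms by (simp add: field_simps)
  then have "exp (ln (1 + a * y)) \<le> exp (a * ln (1 + y))" by simp
  then show ?thesis
    using assms by (simp add: powr_def add_pos_nonneg)
qed

lemma powr_one_plus_le:
  assumes "0 \<le> a" "a \<le> 1" "0 \<le> (y::real)"
  shows "(1 + y) powr a \<le> 1 + a * y"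
proof -
  have "(1 - a) * ln 1 + a * ln (1 + y) \<le> ln ((1 - a) *\<^sub>R 1 + a *\<^sub>R (1 + y))"
    using assms by (intro concave_onD[OF ln_concave]) (auto intro: add_pos_nonneg)
  also have "(1 - a) *\<^sub>R 1 + a *\<^sub>R (1 + y) = 1 + a * y"
    using assms by (simp add: field_simps)
  finally have "exp (a * ln (1 + y)) \<le> exp (ln (1 + a * y))" by simp
  then show ?thesis
    using assms by (simp add: powr_def add_pos_nonneg)
qed

text \<open>Isolates the ratio of successive terms of the scaled sequence. Bernoulli's inequality
  with y = 1 / n decides on which side of 1 it lies: at most 1 for a \<ge> 1, at least 1 for 0 \<le>
  a \<le> 1.\<close>

lemma multichoose_scaled_Suc:
  assumes "n > 0"
  shows "multichoose a (Suc n) * real (Suc n) powr (1 - a) =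
    multichoose a n * real n powr (1 - a) * ((1 + a * (1 / n)) * (1 + 1 / n) powr (- a))"
proof -
  have "real (Suc n) = real n * (1 + 1 / n)" using assms by (simp add: field_simps)
  then have "real (Suc n) powr (1 - a) = real n powr (1 - a) * (1 + 1 / n) powr (1 - a)"
    by (simp add: powr_mult)
  also have "(1 + 1 / real n) powr (1 - a) = (1 + 1 / n) * (1 + 1 / n) powr (- a)"
    using powr_add[of "1 + 1 / real n" 1 "- a"] by (simp add: add_nonneg_nonneg)
  finally have "multichoose a (Suc n) * real (Suc n) powr (1 - a) =
      multichoose a n * real n powr (1 - a) *
        ((a + n) / Suc n * (1 + 1 / n) * (1 + 1 / n) powr (- a))"
    by (simp add: multichoose_Suc)
  moreover have "(a + n) / Suc n * (1 + 1 / n) = 1 + a * (1 / n)"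
  proof -
    have "1 + 1 / real n = Suc n / n" using assms by (simp add: field_simps)
    then have "(a + n) / Suc n * (1 + 1 / n) = (a + n) / n" by simp
    then show ?thesis using assms by (simp add: add_divide_distrib)
  qed
  ultimately show ?thesis by (simp only:)
qed

lemma multichoose_scaled_antimono:
  assumes "1 \<le> a" "0 < m" "m \<le> n"
  shows "multichoose a n * real n powr (1 - a) \<le> multichoose a m * real m powr (1 - a)"
  using assms(3)
proof (induction n rule: dec_induct)
  case (step n)
  have n: "n > 0" using step assms by simp
  have "(1 + a * (1 / n)) * (1 + 1 / n) powr (- a) \<le> (1 + 1 / n) powr a * (1 + 1 / n) powr (- a)"
    using powr_one_plus_ge[of a "1 / n"] assms by (intro mult_right_mono) auto
  also have "\<dots> = 1"
    using n by (simp add: add_nonneg_eq_0_iff flip: powr_add)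
  finally have "multichoose a (Suc n) * real (Suc n) powr (1 - a) \<le> multichoose a n * real n powr (1 - a)"
    unfolding multichoose_scaled_Suc[OF n]
    using assms by (intro mult_left_le) (auto simp: multichoose_nonneg)
  with step show ?case by linarith
qed simp

lemma multichoose_scaled_mono:
  assumes "0 \<le> a" "a \<le> 1" "0 < m" "m \<le> n"
  shows "multichoose a m * real m powr (1 - a) \<le> multichoose a n * real n powr (1 - a)"
  using assms(4)
proof (induction n rule: dec_induct)
  case (step n)
  have n: "n > 0" using step assms by simp
  have "1 = (1 + 1 / n) powr a * (1 + 1 / n) powr (- a)"
    using n by (simp add: add_nonneg_eq_0_iff flip: powr_add)
  also have "\<dots> \<le> (1 + a * (1 / n)) * (1 + 1 / n) powr (- a)"
    using powr_one_plus_le[of a "1 / n"] assms by (intro mult_right_mono) auto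
  finally have "multichoose a n * real n powr (1 - a) \<le> multichoose a (Suc n) * real (Suc n) powr (1 - a)"
    unfolding multichoose_scaled_Suc[OF n]
    using mult_left_mono[of 1 _ "multichoose a n * real n powr (1 - a)"] assms
    by (simp add: multichoose_nonneg)
  with step show ?case by linarith
qed simp

text \<open>A decreasing sequence stays above its limit. This bounds the Mittag-Leffler coefficients
  by discrete ones at a single fixed n.\<close>

lemma inverse_Gamma_le_multichoose_scaled:
  assumes "1 \<le> a" "0 < n"
  shows "1 / Gamma a \<le> multichoose a n * real n powr (1 - a)"
  by (rule tendsto_upperbound[OF multichoose_asymptotics])
     (use assms in \<open>auto intro!: eventually_sequentiallyI[of n] multichoose_scaled_antimono\<close>)

lemma multichoose_scaled_le_inverse_Gamma:
  assumes "0 \<le> a" "a \<le> 1" "0 < n"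
  shows "multichoose a n * real n powr (1 - a) \<le> 1 / Gamma a"
  by (rule tendsto_lowerbound[OF multichoose_asymptotics])
     (use assms in \<open>auto intro!: eventually_sequentiallyI[of n] multichoose_scaled_mono\<close>)

text \<open>With r = |z| this puts \<mu> = z / n^\<alpha> into the unit disc, where the discrete
  series converges.\<close>

lemma obtain_scaled_powr_less_one:
  fixes r \<alpha> :: real
  assumes "0 < \<alpha>"
  obtains N :: nat where "N > 0" "\<And>n. n \<ge> N \<Longrightarrow> r * real n powr (- \<alpha>) < 1"
proof -
  have "(\<lambda>n. r * real n powr (- \<alpha>)) \<longlonglongrightarrow> r * 0"
    using assms by (intro tendsto_intros tendsto_neg_powr filterlim_real_sequentially) auto
  then have "\<forall>\<^sub>F n in sequentially. r * real n powr (- \<alpha>) < 1"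
    by (intro order_tendstoD) auto
  then obtain N where "\<And>n. n \<ge> N \<Longrightarrow> r * real n powr (- \<alpha>) < 1"
    by (auto simp: eventually_sequentially)
  then show ?thesis using that[of "Suc N"] by simp
qed

text \<open>The power n^(- \<alpha> k) merges with r^k, leaving a power series with ratio r n^(-
  \<alpha>) < 1.\<close>

lemma summable_multichoose_scaled:
  fixes r :: real
  assumes "0 \<le> r" "0 < \<alpha>" "0 < \<beta>" "0 < n" "r * real n powr (- \<alpha>) < 1"
  shows "summable (\<lambda>k. r ^ k * (multichoose (\<alpha> * real k + \<beta>) n * real n powr (1 - (\<alpha> * real k + \<beta>))))"
proof -
  have "summable (\<lambda>k. real n powr (1 - \<beta>) * ((r * real n powr (- \<alpha>)) ^ k * multichoose (\<alpha> * real k + \<beta>) n))"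
    using assms by (intro summable_mult summable_multichoose_powser) auto
  moreover have "real n powr (1 - (\<alpha> * real k + \<beta>)) = real n powr (1 - \<beta>) * (real n powr (- \<alpha>)) ^ k" for k
    using assms by (simp add: powr_power algebra_simps flip: powr_add)
  ultimately show ?thesis
    by (simp add: power_mult_distrib mult_ac)
qed

section \<open>The Mittag-Leffler series as limit of the discrete coefficients\<close>

text \<open>As soon as \<alpha> k + \<beta> \<ge> 1, the reciprocal Gamma value is at most the
  scaled coefficient at a fixed N, so the discrete series at N is a majorant.\<close>

lemma summable_mittag_leffler_real:
  fixes r :: real
  assumes "0 \<le> r" "0 < \<alpha>" "0 < \<beta>"
  shows "summable (\<lambda>k. r ^ k / Gamma (\<alpha> * real k + \<beta>))"
proof -
  obtain N where N: "N > 0" "\<And>n. n \<ge> N \<Longrightarrow> r * real n powr (- \<alpha>) < 1"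
    using obtain_scaled_powr_less_one assms by metis
  have "\<forall>\<^sub>F k in sequentially. 1 \<le> \<alpha> * real k + \<beta>"
    using assms by real_asymp
  then have "\<forall>\<^sub>F k in sequentially. norm (r ^ k / Gamma (\<alpha> * real k + \<beta>)) \<le>
      r ^ k * (multichoose (\<alpha> * real k + \<beta>) N * real N powr (1 - (\<alpha> * real k + \<beta>)))"
  proof eventually_elim
    case (elim k)
    then show ?case
      using mult_left_mono[OF inverse_Gamma_le_multichoose_scaled[OF elim N(1)], of "r ^ k"] assms
      by (simp add: abs_mult Gamma_real_pos less_imp_le)
  qed
  then show ?thesis
    by (rule summable_comparison_test_ev) (use assms N in \<open>auto intro!: summable_multichoose_scaled\<close>)
qed

lemma summable_mittag_leffler:
  assumes "0 < \<alpha>" "0 < \<beta>"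
  shows "summable (\<lambda>k. z ^ k / complex_of_real (Gamma (\<alpha> * real k + \<beta>)))"
proof (rule summable_norm_cancel)
  have "\<bar>Gamma (\<alpha> * real k + \<beta>)\<bar> = Gamma (\<alpha> * real k + \<beta>)" for k
    using assms by (intro abs_of_pos Gamma_real_pos add_nonneg_pos) auto
  then show "summable (\<lambda>k. norm (z ^ k / complex_of_real (Gamma (\<alpha> * real k + \<beta>))))"
    using summable_mittag_leffler_real[of "cmod z" \<alpha> \<beta>] assms
    by (simp add: norm_divide norm_power)
qed

lemma mittag_leffler_0 [simp]: "mittag_leffler \<alpha> \<beta> 0 = 1 / complex_of_real (Gamma \<beta>)"
proof -
  have "mittag_leffler \<alpha> \<beta> 0 = (\<Sum>k\<in>{0}. 0 ^ k / complex_of_real (Gamma (\<alpha> * real k + \<beta>)))"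
    unfolding mittag_leffler_def by (rule suminf_finite) auto
  then show ?thesis by simp
qed

lemma continuous_on_mittag_leffler:
  assumes "0 < \<alpha>" "0 < \<beta>"
  shows "continuous_on S (mittag_leffler \<alpha> \<beta>)"
proof -
  have "isCont (\<lambda>z. \<Sum>k. (1 / complex_of_real (Gamma (\<alpha> * real k + \<beta>))) * z ^ k) w" for w
    by (rule isCont_powser_converges_everywhere)
       (use summable_mittag_leffler[OF assms] in simp)
  then have "isCont (mittag_leffler \<alpha> \<beta>) w" for w
    by (simp add: mittag_leffler_def[abs_def])
  then show ?thesis by (simp add: continuous_at_imp_continuous_on)
qed

text \<open>Each term converges by \<open>multichoose_asymptotics\<close>; Tannery's theorem
  exchanges the limit with the sum over k.\<close>

lemma ml_discrete_tendsto_mittag_leffler: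
  assumes "0 < \<alpha>" "0 < \<beta>"
  shows "(\<lambda>n. complex_of_real (real n powr (1 - \<beta>)) *
      ml_discrete \<alpha> \<beta> (z * complex_of_real (real n powr (- \<alpha>))) n) \<longlonglongrightarrow> mittag_leffler \<alpha> \<beta> z"
proof -
  define h where "h k n = multichoose (\<alpha> * real k + \<beta>) n * real n powr (1 - (\<alpha> * real k + \<beta>))" for k n
  define t where "t k n = z ^ k * complex_of_real (h k n)" for k n
  obtain N where N: "N > 0" "\<And>n. n \<ge> N \<Longrightarrow> cmod z * real n powr (- \<alpha>) < 1"
    using obtain_scaled_powr_less_one assms by metis
  have pos: "0 < \<alpha> * real k + \<beta>" for k using assms by (intro add_nonneg_pos) auto
  have h0: "0 \<le> h k n" for k n using pos[of k] by (simp add: h_def multichoose_nonneg)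
  \<comment> \<open>For exponents at least 1, \<open>h k\<close> decreases in n and its value at N
    dominates; for smaller exponents it increases to 1 / Gamma. The sum of both bounds serves every
    k.\<close>
  define B where "B k = cmod z ^ k * h k N + cmod z ^ k / Gamma (\<alpha> * real k + \<beta>)" for k
  have "summable B"
    unfolding B_def h_def using N assms
    by (intro summable_add summable_multichoose_scaled summable_mittag_leffler_real) auto
  have lim: "t k \<longlonglongrightarrow> z ^ k / complex_of_real (Gamma (\<alpha> * real k + \<beta>))" for k
    using tendsto_mult_left[OF tendsto_of_real[OF multichoose_asymptotics[of "\<alpha> * real k + \<beta>"]], of "z ^ k"]
    by (simp add: t_def[abs_def] h_def)
  have bound: "norm (t k n) \<le> B k" if n: "n \<ge> N" for k n
  proof -
    have "h k n \<le> h k N + 1 / Gamma (\<alpha> * real k + \<beta>)"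
    proof (cases "1 \<le> \<alpha> * real k + \<beta>")
      case True
      then have "h k n \<le> h k N" unfolding h_def using N n by (intro multichoose_scaled_antimono) auto
      then show ?thesis using Gamma_real_pos[OF pos[of k]] by (simp add: add_increasing2)
    next
      case False
      then have "h k n \<le> 1 / Gamma (\<alpha> * real k + \<beta>)"
        unfolding h_def using N n pos[of k] by (intro multichoose_scaled_le_inverse_Gamma) auto
      then show ?thesis using h0[of k N] by linarith
    qed
    then have "cmod z ^ k * h k n \<le> cmod z ^ k * (h k N + 1 / Gamma (\<alpha> * real k + \<beta>))"
      by (rule mult_left_mono) simp
    then show ?thesis using h0[of k n] by (simp add: t_def B_def norm_mult norm_power algebra_simps)
  qed
  have "(\<lambda>n. \<Sum>k. t k n) \<longlonglongrightarrow> (\<Sum>k. z ^ k / complex_of_real (Gamma (\<alpha> * real k + \<beta>)))"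
  proof (rule tannerys_theorem[THEN conjunct2, THEN conjunct2])
    show "\<forall>\<^sub>F (k, n) in at_top \<times>\<^sub>F sequentially. norm (t k n) \<le> B k"
      using bound by (auto simp: eventually_prod_filter eventually_sequentially)
  qed (use lim \<open>summable B\<close> in auto)
  moreover have "\<forall>\<^sub>F n in sequentially. (\<Sum>k. t k n) = complex_of_real (real n powr (1 - \<beta>)) *
      ml_discrete \<alpha> \<beta> (z * complex_of_real (real n powr (- \<alpha>))) n"
    using eventually_ge_at_top[of N]
  proof eventually_elim
    case (elim n)
    have n: "n > 0" using elim N by simp
    have "real n powr (1 - (\<alpha> * real k + \<beta>)) = real n powr (1 - \<beta>) * (real n powr (- \<alpha>)) ^ k" for k
      using n by (simp add: powr_power algebra_simps flip: powr_add)
    then have "t k n = complex_of_real (real n powr (1 - \<beta>)) *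
        ((z * complex_of_real (real n powr (- \<alpha>))) ^ k * complex_of_real (multichoose (\<alpha> * real k + \<beta>) n))" for k
      by (simp add: t_def h_def power_mult_distrib mult_ac)
    moreover have "cmod (z * complex_of_real (real n powr (- \<alpha>))) < 1"
      using N(2)[OF elim] by (simp add: norm_mult)
    ultimately show ?case
      unfolding ml_discrete_def
      using suminf_mult[OF summable_ml_discrete[of "z * complex_of_real (real n powr (- \<alpha>))" \<alpha> \<beta> n]] assms
      by simp
  qed
  ultimately show ?thesis
    unfolding mittag_leffler_def by (rule Lim_transform_eventually)
qed

text \<open>Limit of the discrete bound at \<mu> = z / n^\<alpha>: scaling by a nonnegative real
  keeps Re \<mu> \<le> 0, and both sides carry the same factor n^(1 - \<beta>).\<close>

lemma norm_mittag_leffler_le: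
  assumes "0 < \<alpha>" "\<alpha> \<le> 1" "\<alpha> \<le> \<beta>" "Re z \<le> 0"
  shows "cmod (mittag_leffler \<alpha> \<beta> z) \<le> 1 / Gamma \<beta>"
proof (rule tendsto_le)
  show "(\<lambda>n. cmod (complex_of_real (real n powr (1 - \<beta>)) *
      ml_discrete \<alpha> \<beta> (z * complex_of_real (real n powr (- \<alpha>))) n)) \<longlonglongrightarrow> cmod (mittag_leffler \<alpha> \<beta> z)"
    using assms by (intro tendsto_norm ml_discrete_tendsto_mittag_leffler) auto
  show "(\<lambda>n. multichoose \<beta> n * real n powr (1 - \<beta>)) \<longlonglongrightarrow> 1 / Gamma \<beta>"
    by (rule multichoose_asymptotics)
  obtain N where N: "N > 0" "\<And>n. n \<ge> N \<Longrightarrow> cmod z * real n powr (- \<alpha>) < 1"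
    using obtain_scaled_powr_less_one assms by metis
  show "\<forall>\<^sub>F n in sequentially. cmod (complex_of_real (real n powr (1 - \<beta>)) *
      ml_discrete \<alpha> \<beta> (z * complex_of_real (real n powr (- \<alpha>))) n) \<le> multichoose \<beta> n * real n powr (1 - \<beta>)"
    using eventually_ge_at_top[of N]
  proof eventually_elim
    case (elim n)
    then show ?case
      using norm_ml_discrete_le[of "z * complex_of_real (real n powr (- \<alpha>))" \<alpha> \<beta> n] N assms
      by (simp add: norm_mult mult_left_mono mult_nonpos_nonneg mult.commute)
  qed
qed simp

section \<open>Multipliers in the spectral representation\<close>

lemma norm_scaleC: "norm (c *\<^sub>C x) = cmod c * norm (x :: 'h :: complex_inner)"
proof -
  have "cinner (c *\<^sub>C x) (c *\<^sub>C x) = (c * cnj c) * cnj (cinner x x)"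
    by (simp add: cinner_scaleC_right cinner_commute[of "c *\<^sub>C x" x])
  then have "inner (c *\<^sub>C x) (c *\<^sub>C x) = (cmod c)\<^sup>2 * inner x x"
    by (simp add: inner_eq_Re_cinner flip: complex_norm_square)
  then have "(norm (c *\<^sub>C x))\<^sup>2 = (cmod c * norm x)\<^sup>2"
    by (simp add: power2_norm_eq_inner power_mult_distrib)
  then show ?thesis by (simp add: power2_eq_iff_nonneg)
qed

lemma scaleC_diff_right: "c *\<^sub>C (x - y) = c *\<^sub>C x - c *\<^sub>C (y :: 'h :: complex_inner)"
  using scaleC_add_right[of c "x - y" y] by (simp add: algebra_simps)

lemma tendsto_scaleC:
  fixes f :: "'b \<Rightarrow> 'h :: complex_inner"
  assumes "(f \<longlongrightarrow> l) G"
  shows "((\<lambda>x. c *\<^sub>C f x) \<longlongrightarrow> c *\<^sub>C l) G"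
proof -
  have "((\<lambda>x. cmod c * norm (f x - l)) \<longlongrightarrow> cmod c * 0) G"
    using assms by (intro tendsto_mult_left tendsto_norm_zero LIM_zero)
  then have "((\<lambda>x. norm (c *\<^sub>C f x - c *\<^sub>C l)) \<longlongrightarrow> 0) G"
    by (simp add: norm_scaleC flip: scaleC_diff_right)
  then show ?thesis
    using tendsto_norm_zero_iff LIM_zero_iff by blast
qed

lemma L2_diff:
  assumes "f \<in> L2 M" "g \<in> L2 M"
  shows "(\<lambda>\<xi>. f \<xi> - g \<xi>) \<in> L2 M"
proof -
  have [measurable]: "f \<in> borel_measurable M" "g \<in> borel_measurable M"
    using assms by (auto simp: L2_def)
  have "integrable M (\<lambda>\<xi>. 2 * (cmod (f \<xi>))\<^sup>2 + 2 * (cmod (g \<xi>))\<^sup>2)"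
    using assms by (auto simp: L2_def)
  moreover have "(cmod (f \<xi> - g \<xi>))\<^sup>2 \<le> 2 * (cmod (f \<xi>))\<^sup>2 + 2 * (cmod (g \<xi>))\<^sup>2" for \<xi>
  proof -
    have "(cmod (f \<xi> - g \<xi>))\<^sup>2 \<le> (cmod (f \<xi>) + cmod (g \<xi>))\<^sup>2"
      by (intro power_mono norm_triangle_ineq4) simp
    also have "\<dots> \<le> 2 * (cmod (f \<xi>))\<^sup>2 + 2 * (cmod (g \<xi>))\<^sup>2"
      using sum_squares_bound[of "cmod (f \<xi>)" "cmod (g \<xi>)"] by (simp add: power2_sum)
    finally show ?thesis .
  qed
  ultimately have "integrable M (\<lambda>\<xi>. (cmod (f \<xi> - g \<xi>))\<^sup>2)"
    by (auto elim!: Bochner_Integration.integrable_bound)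
  then show ?thesis by (auto simp: L2_def)
qed

lemma L2_mult_bounded:
  assumes "m \<in> borel_measurable M" "\<And>\<xi>. cmod (m \<xi>) \<le> C" "f \<in> L2 M"
  shows "(\<lambda>\<xi>. m \<xi> * f \<xi>) \<in> L2 M"
proof -
  have [measurable]: "f \<in> borel_measurable M" "m \<in> borel_measurable M"
    using assms by (auto simp: L2_def)
  have "integrable M (\<lambda>\<xi>. C\<^sup>2 * (cmod (f \<xi>))\<^sup>2)"
    using assms by (auto simp: L2_def)
  then have "integrable M (\<lambda>\<xi>. (cmod (m \<xi> * f \<xi>))\<^sup>2)"
    by (rule Bochner_Integration.integrable_bound)
       (auto simp: norm_mult power_mult_distrib intro!: mult_right_mono power_mono assms)
  then show ?thesis by (auto simp: L2_def)
qed

lemma unitary_L2_norm: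
  assumes "unitary_L2 M U" "f \<in> L2 M"
  shows "(norm (U f))\<^sup>2 = (LINT \<xi>|M. (cmod (f \<xi>))\<^sup>2)"
proof -
  have "(norm (U f))\<^sup>2 = Re (LINT \<xi>|M. cnj (f \<xi>) * f \<xi>)"
    using assms by (simp add: unitary_L2_def power2_norm_eq_inner inner_eq_Re_cinner)
  also have "(\<lambda>\<xi>. cnj (f \<xi>) * f \<xi>) = (\<lambda>\<xi>. complex_of_real ((cmod (f \<xi>))\<^sup>2))"
    by (simp only: complex_norm_square mult.commute)
  finally show ?thesis by (simp del: of_real_power)
qed

lemma unitary_L2_diff:
  assumes "unitary_L2 M U" "f \<in> L2 M" "g \<in> L2 M"
  shows "U f - U g = U (\<lambda>\<xi>. f \<xi> - g \<xi>)"
proof -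
  have "U (\<lambda>\<xi>. (f \<xi> - g \<xi>) + g \<xi>) = U (\<lambda>\<xi>. f \<xi> - g \<xi>) + U g"
    using assms L2_diff[OF assms(2,3)] unfolding unitary_L2_def
    by (elim conjE) (drule (1) bspec, erule (1) bspec)
  then show ?thesis by simp
qed

lemma
  assumes "unitary_L2 M U"
  shows U_inv_in_L2: "U_inv M U \<phi> \<in> L2 M"
    and U_U_inv: "U (U_inv M U \<phi>) = \<phi>"
proof -
  have "\<phi> \<in> U ` L2 M" using assms by (simp add: unitary_L2_def)
  then show "U_inv M U \<phi> \<in> L2 M" "U (U_inv M U \<phi>) = \<phi>"
    unfolding U_inv_def by (rule inv_into_into, rule f_inv_into_f)
qed

section \<open>Bounded multipliers: estimates, strong convergence and joint continuity\<close>

text \<open>Homogeneity of \<open>U\<close> is available only on \<open>L2 M\<close>; the bound on m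
  ensures that the product lies there.\<close>

lemma multiplier_scale:
  assumes "unitary_L2 M U" "m \<in> borel_measurable M" "\<And>\<xi>. cmod (m \<xi>) \<le> C"
  shows "multiplier M U (\<lambda>\<xi>. c * m \<xi>) \<phi> = c *\<^sub>C multiplier M U m \<phi>"
  using assms(1) L2_mult_bounded[OF assms(2,3) U_inv_in_L2[OF assms(1)]]
  by (simp add: multiplier_def unitary_L2_def mult.assoc)

lemma multiplier_const:
  assumes "unitary_L2 M U"
  shows "multiplier M U (\<lambda>\<xi>. c) \<phi> = c *\<^sub>C \<phi>"
  using assms U_inv_in_L2[OF assms] U_U_inv[OF assms]
  by (simp add: multiplier_def unitary_L2_def)

text \<open>Stated for any f in \<open>L2 M\<close>, because differences of values of
  \<open>U_inv\<close> are needed later, and \<open>U_inv\<close> is additive only up to null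
  sets.\<close>

lemma norm_unitary_L2_mult_le:
  assumes U: "unitary_L2 M U" and m: "m \<in> borel_measurable M" "\<And>\<xi>. cmod (m \<xi>) \<le> C"
    and f: "f \<in> L2 M"
  shows "norm (U (\<lambda>\<xi>. m \<xi> * f \<xi>)) \<le> C * norm (U f)"
proof -
  have mf: "(\<lambda>\<xi>. m \<xi> * f \<xi>) \<in> L2 M" by (rule L2_mult_bounded[OF m f])
  have C: "0 \<le> C" using m(2) norm_ge_zero order_trans by blast
  have "(norm (U (\<lambda>\<xi>. m \<xi> * f \<xi>)))\<^sup>2 = (LINT \<xi>|M. (cmod (m \<xi> * f \<xi>))\<^sup>2)"
    by (rule unitary_L2_norm[OF U mf])
  also have "\<dots> \<le> (LINT \<xi>|M. C\<^sup>2 * (cmod (f \<xi>))\<^sup>2)"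
    using f mf
    by (intro integral_mono)
       (auto simp: L2_def norm_mult power_mult_distrib intro!: mult_right_mono power_mono m)
  also have "\<dots> = (C * norm (U f))\<^sup>2"
    using unitary_L2_norm[OF U f] by (simp add: power_mult_distrib)
  finally show ?thesis by (rule power2_le_imp_le) (simp add: C)
qed

lemma norm_multiplier_le:
  assumes U: "unitary_L2 M U" and m: "m \<in> borel_measurable M" "\<And>\<xi>. cmod (m \<xi>) \<le> C"
  shows "norm (multiplier M U m \<phi>) \<le> C * norm \<phi>"
  using norm_unitary_L2_mult_le[OF U m U_inv_in_L2[OF U], of \<phi>]
  by (simp add: multiplier_def U_U_inv[OF U])

lemma norm_multiplier_diff_le:
  assumes U: "unitary_L2 M U" and m: "m \<in> borel_measurable M" "\<And>\<xi>. cmod (m \<xi>) \<le> C"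
  shows "norm (multiplier M U m \<phi> - multiplier M U m \<psi>) \<le> C * norm (\<phi> - \<psi>)"
proof -
  let ?f = "\<lambda>\<xi>. U_inv M U \<phi> \<xi> - U_inv M U \<psi> \<xi>"
  have "multiplier M U m \<phi> - multiplier M U m \<psi> = U (\<lambda>\<xi>. m \<xi> * ?f \<xi>)"
    unfolding multiplier_def
    by (simp add: right_diff_distrib unitary_L2_diff[OF U] L2_mult_bounded[OF m] U_inv_in_L2[OF U])
  moreover have "U ?f = \<phi> - \<psi>"
    using unitary_L2_diff[OF U U_inv_in_L2[OF U] U_inv_in_L2[OF U], of \<phi> \<psi>] U_U_inv[OF U] by simp
  moreover have "?f \<in> L2 M" by (intro L2_diff U_inv_in_L2 U)
  ultimately show ?thesis
    using norm_unitary_L2_mult_le[OF U m, of ?f] by simp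
qed

text \<open>Dominated convergence in the spectral variable with majorant (2 C)^2 |f|^2. Pointwise
  convergence of the symbols gives strong convergence; convergence uniform in \<xi> cannot be
  expected when a is unbounded.\<close>

lemma multiplier_tendsto:
  fixes m :: "nat \<Rightarrow> 'w \<Rightarrow> complex"
  assumes U: "unitary_L2 M U"
    and m: "\<And>n. m n \<in> borel_measurable M" "\<And>n \<xi>. cmod (m n \<xi>) \<le> C"
    and m': "m' \<in> borel_measurable M" "\<And>\<xi>. cmod (m' \<xi>) \<le> C"
    and lim: "\<And>\<xi>. (\<lambda>n. m n \<xi>) \<longlonglongrightarrow> m' \<xi>"
  shows "(\<lambda>n. multiplier M U (m n) \<phi>) \<longlonglongrightarrow> multiplier M U m' \<phi>"
proof -
  let ?f = "U_inv M U \<phi>"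
  have f: "?f \<in> L2 M" by (rule U_inv_in_L2[OF U])
  have [measurable]: "?f \<in> borel_measurable M" using f by (simp add: L2_def)
  note [measurable] = m(1) m'(1)
  have bd: "cmod (m n \<xi> - m' \<xi>) \<le> 2 * C" for n \<xi>
    using norm_triangle_ineq4[of "m n \<xi>" "m' \<xi>"] m(2)[of n \<xi>] m'(2)[of \<xi>] by simp
  have d: "(\<lambda>\<xi>. (m n \<xi> - m' \<xi>) * ?f \<xi>) \<in> L2 M" for n
    by (rule L2_mult_bounded[where C = "2 * C"]) (auto intro!: f bd)
  have eq: "(norm (multiplier M U (m n) \<phi> - multiplier M U m' \<phi>))\<^sup>2 =
      (LINT \<xi>|M. (cmod ((m n \<xi> - m' \<xi>) * ?f \<xi>))\<^sup>2)" for n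
    unfolding multiplier_def
    unfolding unitary_L2_diff[OF U L2_mult_bounded[OF m f] L2_mult_bounded[OF m' f]]
    using unitary_L2_norm[OF U d] by (simp add: left_diff_distrib)
  have "(\<lambda>n. LINT \<xi>|M. (cmod ((m n \<xi> - m' \<xi>) * ?f \<xi>))\<^sup>2) \<longlonglongrightarrow> (LINT \<xi>|M. 0)"
  proof (rule integral_dominated_convergence)
    show "integrable M (\<lambda>\<xi>. (2 * C)\<^sup>2 * (cmod (?f \<xi>))\<^sup>2)"
      using f by (auto simp: L2_def)
    have "(\<lambda>n. (cmod ((m n \<xi> - m' \<xi>) * ?f \<xi>))\<^sup>2) \<longlonglongrightarrow> (cmod ((m' \<xi> - m' \<xi>) * ?f \<xi>))\<^sup>2" for \<xi>
      by (intro tendsto_intros lim)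
    then show "AE \<xi> in M. (\<lambda>n. (cmod ((m n \<xi> - m' \<xi>) * ?f \<xi>))\<^sup>2) \<longlonglongrightarrow> 0" by simp
    show "AE \<xi> in M. norm ((cmod ((m n \<xi> - m' \<xi>) * ?f \<xi>))\<^sup>2) \<le> (2 * C)\<^sup>2 * (cmod (?f \<xi>))\<^sup>2" for n
      using power_mono[OF bd norm_ge_zero, where n = 2]
      by (intro AE_I2) (auto simp: norm_mult power_mult_distrib intro!: mult_right_mono)
  qed auto
  then have "(\<lambda>n. sqrt ((norm (multiplier M U (m n) \<phi> - multiplier M U m' \<phi>))\<^sup>2)) \<longlonglongrightarrow> sqrt 0"
    unfolding eq by (intro tendsto_real_sqrt) simp
  then show ?thesis
    by (simp add: tendsto_norm_zero_iff LIM_zero_iff)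
qed

text \<open>The operators are Lipschitz in the vector with constant C for all y, and strongly
  continuous in y; together this gives joint continuity.\<close>

lemma continuous_on_multiplier:
  fixes m :: "real \<Rightarrow> 'w \<Rightarrow> complex" and U :: "('w \<Rightarrow> complex) \<Rightarrow> 'h :: complex_hilbert_space"
  assumes U: "unitary_L2 M U"
    and m: "\<And>y. m y \<in> borel_measurable M" "\<And>y \<xi>. cmod (m y \<xi>) \<le> C"
    and cont: "\<And>\<xi>. continuous_on UNIV (\<lambda>y. m y \<xi>)"
  shows "continuous_on UNIV (\<lambda>p. multiplier M U (m (fst p)) (snd p))"
  unfolding continuous_on_sequentially comp_def
proof (intro allI ballI impI, elim conjE)
  fix p :: "nat \<Rightarrow> real \<times> 'h" and q assume "p \<longlonglongrightarrow> q"
  then have p: "(\<lambda>n. fst (p n)) \<longlonglongrightarrow> fst q" "(\<lambda>n. snd (p n)) \<longlonglongrightarrow> snd q"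
    by (auto intro: tendsto_intros)
  have lim: "(\<lambda>n. multiplier M U (m (fst (p n))) (snd q)) \<longlonglongrightarrow> multiplier M U (m (fst q)) (snd q)"
    using cont p(1) by (intro multiplier_tendsto[OF U, where C = C] m) (auto intro: continuous_on_tendsto_compose[where s = UNIV])
  have "(\<lambda>n. multiplier M U (m (fst (p n))) (snd (p n)) - multiplier M U (m (fst (p n))) (snd q)) \<longlonglongrightarrow> 0"
  proof (rule Lim_null_comparison)
    show "\<forall>\<^sub>F n in sequentially. norm (multiplier M U (m (fst (p n))) (snd (p n)) -
        multiplier M U (m (fst (p n))) (snd q)) \<le> C * norm (snd (p n) - snd q)"
      by (intro always_eventually allI norm_multiplier_diff_le U m)
    show "(\<lambda>n. C * norm (snd (p n) - snd q)) \<longlonglongrightarrow> 0"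
      using p(2) by (intro tendsto_mult_right_zero tendsto_norm_zero) (simp add: LIM_zero_iff)
  qed
  from tendsto_add[OF this lim]
  show "(\<lambda>n. multiplier M U (m (fst (p n))) (snd (p n))) \<longlonglongrightarrow> multiplier M U (m (fst q)) (snd q)"
    by simp
qed

section \<open>The fractional kernel in time and measurability of the symbols\<close>

text \<open>For \<alpha> < 1 the kernel is singular at \<tau> = t, but as \<alpha> > 0 its
  antiderivative is continuous up to t. The fundamental theorem with derivatives only in the
  interior applies, and positivity makes the integral absolute.\<close>

lemma set_integrable_powr_reflected:
  fixes \<alpha> t :: real
  assumes "0 < \<alpha>" "0 \<le> t"
  shows "set_integrable lebesgue {0<..<t} (\<lambda>\<tau>. (t - \<tau>) powr (\<alpha> - 1))"
proof -
  have "((\<lambda>\<tau>. (t - \<tau>) powr (\<alpha> - 1)) has_integral (- ((t - t) powr \<alpha> / \<alpha>) - - ((t - 0) powr \<alpha> / \<alpha>))) {0..t}"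
  proof (rule fundamental_theorem_of_calculus_interior)
    show "continuous_on {0..t} (\<lambda>\<tau>. - ((t - \<tau>) powr \<alpha> / \<alpha>))"
      using assms by (intro continuous_intros continuous_on_powr') auto
    fix \<tau> assume "\<tau> \<in> {0<..<t}"
    then show "((\<lambda>\<tau>. - ((t - \<tau>) powr \<alpha> / \<alpha>)) has_vector_derivative (t - \<tau>) powr (\<alpha> - 1)) (at \<tau>)"
      using assms
      by (auto intro!: derivative_eq_intros simp: powr_diff simp flip: has_real_derivative_iff_has_vector_derivative)
  qed (use assms in auto)
  then have "(\<lambda>\<tau>. (t - \<tau>) powr (\<alpha> - 1)) absolutely_integrable_on {0..t}"
    by (intro nonnegative_absolutely_integrable_1) auto
  then show ?thesis
    by (rule set_integrable_subset) auto
qed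

lemma measurable_mittag_leffler_symbol:
  assumes "0 < \<alpha>" "0 < \<beta>" "a \<in> borel_measurable M"
  shows "(\<lambda>\<xi>. mittag_leffler \<alpha> \<beta> (\<i> * complex_of_real (a \<xi> * y))) \<in> borel_measurable M"
proof -
  have [measurable]: "mittag_leffler \<alpha> \<beta> \<in> borel_measurable borel"
    using assms by (intro borel_measurable_continuous_onI continuous_on_mittag_leffler)
  note [measurable] = assms(3)
  show ?thesis by measurable
qed

section \<open>The limit of the mild solutions\<close>

theorem theoremD4:
  fixes \<alpha> :: real
    and D :: "'h::{complex_hilbert_space, second_countable_topology} set"
    and A :: "'h \<Rightarrow> 'h"
    and M :: "'w measure"
    and U :: "('w \<Rightarrow> complex) \<Rightarrow> 'h"
    and a :: "'w \<Rightarrow> real"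
    and F :: "real \<Rightarrow> 'h"
    and x :: 'h
    and u :: "real \<Rightarrow> real \<Rightarrow> 'h"
  assumes "0 < \<alpha>" and "\<alpha> < 1"
    and "selfadjoint_operator D A"
    and "spectral_representation M U a D A"
    and "L_infinity_half_line F"
    and "\<And>\<epsilon> t. \<epsilon> > 0 \<Longrightarrow> t \<ge> 0 \<Longrightarrow>
           u \<epsilon> t = mild_solution \<alpha> M U (\<lambda>\<xi>. \<epsilon> * a \<xi>) F x t"
  shows "\<forall>t\<ge>0. ((\<lambda>\<epsilon>. u \<epsilon> t) \<longlongrightarrow> x + \<i> *\<^sub>C riemann_liouville_integral \<alpha> F t) (at_right 0)"
proof (intro allI impI)
  fix t :: real assume t: "0 \<le> t"
  have U: "unitary_L2 M U" and a: "a \<in> borel_measurable M"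
    using assms(4) by (auto simp: spectral_representation_def)
  \<comment> \<open>Both solution operators for \<epsilon> A come from one family: \<beta> = 1 for
    \<open>S_op\<close>, and \<beta> = \<alpha> for \<open>P_op\<close> up to its power of time. The
    parameter \<epsilon> enters only through y.\<close>
  define m where "m \<beta> y \<xi> = mittag_leffler \<alpha> \<beta> (\<i> * complex_of_real (a \<xi> * y))" for \<beta> y \<xi>
  define T where "T \<beta> y \<phi> = multiplier M U (m \<beta> y) \<phi>" for \<beta> y \<phi>
  have m_meas: "m \<beta> y \<in> borel_measurable M" if "\<alpha> \<le> \<beta>" for \<beta> y
    unfolding m_def using that assms a by (intro measurable_mittag_leffler_symbol) auto
  \<comment> \<open>The argument is purely imaginary for all real y and a \<xi>, whatever their
    signs, so the bound is uniform in y and \<xi>.\<close>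
  have m_le: "cmod (m \<beta> y \<xi>) \<le> 1 / Gamma \<beta>" if "\<alpha> \<le> \<beta>" for \<beta> y \<xi>
    unfolding m_def using that assms by (intro norm_mittag_leffler_le) auto
  have m_cont: "continuous_on UNIV (\<lambda>y. m \<beta> y \<xi>)" if "\<alpha> \<le> \<beta>" for \<beta> \<xi>
    unfolding m_def using that assms
    by (intro continuous_on_compose2[OF continuous_on_mittag_leffler[of \<alpha> \<beta> UNIV]] continuous_intros) auto
  have T_cont: "continuous_on UNIV (\<lambda>p. T \<beta> (fst p) (snd p))" if "\<alpha> \<le> \<beta>" for \<beta>
    unfolding T_def using that by (intro continuous_on_multiplier[OF U, where C = "1 / Gamma \<beta>"] m_meas m_le m_cont)
  have T_0: "T \<beta> 0 \<phi> = (1 / Gamma \<beta>) *\<^sub>R \<phi>" for \<beta> \<phi>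
    using multiplier_const[OF U, of "1 / complex_of_real (Gamma \<beta>)" \<phi>]
    by (simp add: T_def m_def[abs_def] scaleR_eq_scaleC)
  have T_norm: "norm (T \<beta> y \<phi>) \<le> 1 / Gamma \<beta> * norm \<phi>" if "\<alpha> \<le> \<beta>" for \<beta> y \<phi>
    unfolding T_def by (intro norm_multiplier_le U m_meas m_le that)
  have T_lim: "((\<lambda>\<epsilon>. T \<beta> (\<epsilon> * y) \<phi>) \<longlongrightarrow> (1 / Gamma \<beta>) *\<^sub>R \<phi>) (at_right 0)" if "\<alpha> \<le> \<beta>" for \<beta> y \<phi>
  proof -
    have "((\<lambda>\<epsilon>. (\<epsilon> * y, \<phi>)) \<longlongrightarrow> (0 * y, \<phi>)) (at_right 0)" by (intro tendsto_intros)
    from continuous_on_tendsto_compose[OF T_cont[OF that] this] show ?thesis by (simp add: T_0)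
  qed

  obtain C where C: "AE \<tau> in lebesgue_on {0<..}. norm (F \<tau>) \<le> C"
    and F: "F \<in> borel_measurable (lebesgue_on {0<..})"
    using assms(5) by (auto simp: L_infinity_half_line_def)
  \<comment> \<open>Extension by zero: \<open>F\<close> is measurable only on the open half-line,
    whereas the integrals are taken over the whole line.\<close>
  define G where "G \<tau> = indicator {0<..} \<tau> *\<^sub>R F \<tau>" for \<tau> :: real
  have G [measurable]: "G \<in> borel_measurable lebesgue"
    using F by (simp add: G_def[abs_def] borel_measurable_restrict_space_iff)
  have AE_F: "AE \<tau> in lebesgue. 0 < \<tau> \<longrightarrow> norm (F \<tau>) \<le> C"
    using C by (simp add: AE_restrict_space_iff)
  have id [measurable]: "(\<lambda>\<tau>::real. \<tau>) \<in> borel_measurable lebesgue"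
    by (simp add: measurable_completion)

  define f where "f \<epsilon> \<tau> = indicator {0<..<t} \<tau> *\<^sub>R
      (t - \<tau>) powr (\<alpha> - 1) *\<^sub>R T \<alpha> (\<epsilon> * (t - \<tau>) powr \<alpha>) (G \<tau>)" for \<epsilon> \<tau>
  \<comment> \<open>The factor 1 / Gamma(\<alpha>) is the Mittag-Leffler value at 0; it is exactly
    the normalization of the Riemann-Liouville integral.\<close>
  define g where "g \<tau> = indicator {0<..<t} \<tau> *\<^sub>R (t - \<tau>) powr (\<alpha> - 1) *\<^sub>R (1 / Gamma \<alpha>) *\<^sub>R G \<tau>" for \<tau>
  have f_meas [measurable]: "f \<epsilon> \<in> borel_measurable lebesgue" for \<epsilon>
  proof -
    \<comment> \<open>Operator parameter and vector both depend on \<tau>, so joint continuity of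
      \<open>T\<close> is what yields measurability.\<close>
    have [measurable]: "(\<lambda>\<tau>. T \<alpha> (\<epsilon> * (t - \<tau>) powr \<alpha>) (G \<tau>)) \<in> borel_measurable lebesgue"
    proof (rule borel_measurable_continuous_Pair[OF _ G T_cont])
      show "(\<lambda>\<tau>. \<epsilon> * (t - \<tau>) powr \<alpha>) \<in> borel_measurable lebesgue" by measurable
    qed simp
    show ?thesis unfolding f_def by measurable
  qed
  have g_meas [measurable]: "g \<in> borel_measurable lebesgue"
    unfolding g_def by measurable
  have f_lim: "((\<lambda>\<epsilon>. LINT \<tau>|lebesgue. f \<epsilon> \<tau>) \<longlongrightarrow> (LINT \<tau>|lebesgue. g \<tau>)) (at_right 0)"
  \<comment> \<open>Dominated convergence is a statement on sequences; 1 is an arbitrary right end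
    of the range of \<epsilon>.\<close>
  proof (rule tendsto_at_right_sequentially[of 0 1])
    fix S :: "nat \<Rightarrow> real"
    assume S: "\<And>n. 0 < S n" "S \<longlonglongrightarrow> 0"
    then have S': "filterlim S (at_right 0) sequentially"
      by (simp add: filterlim_at less_imp_neq[THEN not_sym])
    show "(\<lambda>n. LINT \<tau>|lebesgue. f (S n) \<tau>) \<longlonglongrightarrow> (LINT \<tau>|lebesgue. g \<tau>)"
    proof (rule integral_dominated_convergence)
      \<comment> \<open>The majorant is the kernel times the bound of \<open>T \<alpha>\<close> and
        the essential bound of \<open>F\<close>; it is independent of \<epsilon>.\<close>
      show "integrable lebesgue (\<lambda>\<tau>. indicator {0<..<t} \<tau> *\<^sub>R (t - \<tau>) powr (\<alpha> - 1) * (1 / Gamma \<alpha> * C))"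
        using set_integrable_powr_reflected[OF assms(1) t] by (simp add: set_integrable_def)
      show "AE \<tau> in lebesgue. (\<lambda>n. f (S n) \<tau>) \<longlonglongrightarrow> g \<tau>"
        unfolding f_def g_def
        by (intro AE_I2 tendsto_scaleR tendsto_const filterlim_compose[OF T_lim S']) simp
      show "AE \<tau> in lebesgue. norm (f (S n) \<tau>) \<le>
          indicator {0<..<t} \<tau> *\<^sub>R (t - \<tau>) powr (\<alpha> - 1) * (1 / Gamma \<alpha> * C)" for n
        using AE_F
      proof eventually_elim
        case (elim \<tau>)
        show ?case
        proof (cases "\<tau> \<in> {0<..<t}")
          case True
          have "norm (T \<alpha> (S n * (t - \<tau>) powr \<alpha>) (G \<tau>)) \<le> 1 / Gamma \<alpha> * norm (G \<tau>)"
            by (rule T_norm) simp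
          also have "\<dots> \<le> 1 / Gamma \<alpha> * C"
            using True elim Gamma_real_pos[OF assms(1)]
            by (intro mult_left_mono) (auto simp: G_def)
          finally have "(t - \<tau>) powr (\<alpha> - 1) * norm (T \<alpha> (S n * (t - \<tau>) powr \<alpha>) (G \<tau>)) \<le>
              (t - \<tau>) powr (\<alpha> - 1) * (1 / Gamma \<alpha> * C)"
            by (rule mult_left_mono) simp
          then show ?thesis
            using True by (simp add: f_def)
        qed (simp add: f_def)
      qed
    qed measurable
  qed simp
  have P_eq: "(LINT \<tau>:{0<..<t}|lebesgue. P_op \<alpha> M U (\<lambda>\<xi>. \<epsilon> * a \<xi>) (t - \<tau>) (F \<tau>)) =
      (LINT \<tau>|lebesgue. f \<epsilon> \<tau>)" for \<epsilon>
    unfolding set_lebesgue_integral_def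
  proof (rule Bochner_Integration.integral_cong)
    fix \<tau> :: real
    have "P_op \<alpha> M U (\<lambda>\<xi>. \<epsilon> * a \<xi>) (t - \<tau>) (F \<tau>) =
        multiplier M U (\<lambda>\<xi>. complex_of_real ((t - \<tau>) powr (\<alpha> - 1)) * m \<alpha> (\<epsilon> * (t - \<tau>) powr \<alpha>) \<xi>) (F \<tau>)"
      by (simp add: P_op_def m_def mult_ac)
    also have "\<dots> = (t - \<tau>) powr (\<alpha> - 1) *\<^sub>R T \<alpha> (\<epsilon> * (t - \<tau>) powr \<alpha>) (F \<tau>)"
      by (simp add: T_def scaleR_eq_scaleC multiplier_scale[OF U m_meas m_le])
    finally show "indicator {0<..<t} \<tau> *\<^sub>R P_op \<alpha> M U (\<lambda>\<xi>. \<epsilon> * a \<xi>) (t - \<tau>) (F \<tau>) = f \<epsilon> \<tau>"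
      by (auto simp: f_def G_def indicator_def)
  qed simp
  have RL_eq: "riemann_liouville_integral \<alpha> F t = (LINT \<tau>|lebesgue. g \<tau>)"
  proof -
    have "riemann_liouville_integral \<alpha> F t =
        (LINT \<tau>:{0<..<t}|lebesgue. (1 / Gamma \<alpha>) *\<^sub>R (t - \<tau>) powr (\<alpha> - 1) *\<^sub>R F \<tau>)"
      unfolding riemann_liouville_integral_def by (rule set_integral_scaleR_right[symmetric])
    also have "\<dots> = (LINT \<tau>|lebesgue. g \<tau>)"
      unfolding set_lebesgue_integral_def
      by (intro Bochner_Integration.integral_cong) (auto simp: g_def G_def indicator_def)
    finally show ?thesis .
  qed
  \<comment> \<open>The time t = 0 is included: \<open>0 powr \<alpha> = 0\<close>, and the
    integrals then run over an empty interval.\<close>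
  have "S_op \<alpha> M U (\<lambda>\<xi>. \<epsilon> * a \<xi>) t x = T 1 (\<epsilon> * t powr \<alpha>) x" for \<epsilon>
    by (simp add: S_op_def T_def m_def[abs_def] mult_ac)
  then have u_eq: "u \<epsilon> t = T 1 (\<epsilon> * t powr \<alpha>) x + \<i> *\<^sub>C (LINT \<tau>|lebesgue. f \<epsilon> \<tau>)" if "0 < \<epsilon>" for \<epsilon>
    using assms(6)[OF that t] by (simp add: mild_solution_def P_eq)
  have "((\<lambda>\<epsilon>. T 1 (\<epsilon> * t powr \<alpha>) x + \<i> *\<^sub>C (LINT \<tau>|lebesgue. f \<epsilon> \<tau>)) \<longlongrightarrow>
      (1 / Gamma 1) *\<^sub>R x + \<i> *\<^sub>C riemann_liouville_integral \<alpha> F t) (at_right 0)"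
    unfolding RL_eq using assms by (intro tendsto_add tendsto_scaleC T_lim f_lim) auto
  moreover have "\<forall>\<^sub>F \<epsilon> in at_right 0. T 1 (\<epsilon> * t powr \<alpha>) x + \<i> *\<^sub>C (LINT \<tau>|lebesgue. f \<epsilon> \<tau>) = u \<epsilon> t"
    using eventually_at_right_less[of "0::real"] by eventually_elim (simp add: u_eq)
  ultimately show "((\<lambda>\<epsilon>. u \<epsilon> t) \<longlongrightarrow> x + \<i> *\<^sub>C riemann_liouville_integral \<alpha> F t) (at_right 0)"
    by (simp add: Lim_transform_eventually)
qed

end
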